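(* Let $m\ge 2$ be an integer and let $\mathcal G=(\mathcal E,\{m_e=m\},\{d_i\})$ be a tensor network whose underlying graph is a finite connected simple graph with vertices $i=1,\dots,N$ and edge set $\mathcal E$, with all bond dimensions equal to $m$. If the graph contains at least one loop (cycle) and the site dimensions obey $d_i\ge m^{z_i}$ for every vertex $i$, where $z_i$ is the degree of vertex $i$, then the set $\mathrm{PEPS}(\mathcal G)$ of normalized projected entangled-pair states for $\mathcal G$ is not a closed subset of $\bigotimes_{i=1}^N\mathbb C^{d_i}$.
   Context: Each $\mathbb C^{d_i}$ has orthonormal basis $\{|\sigma_i\rangle:\sigma_i=1,\dots,d_i\}$. Closedness is with respect to the norm topology. For a network $\mathcal G=(\mathcal E,\{m_e\},\{d_i\})$ let $\partial i\subseteq\mathcal E$ be the set of edges incident to vertex $i$. A PEPS for $\mathcal G$ is obtained by assigning to each vertex $i$ a tensor $A_i\in\mathbb C^{d_i\times\prod_{e\in\partial i}m_e}$, with one physical index $\sigma_i$ and one bond index $n_e\in\{1,\dots,m_e\}$ for each $e\in\partial i$, and contracting: $$|\Psi\rangle=\sum_{\sigma_1,\dots,\sigma_N}\ \sum_{\{n_e\}_{e\in\mathcal E}}\ \prod_{i=1}^N[A_i^{\sigma_i}]_{(n_e)_{e\in\partial i}}\ |\sigma_1,\dots,\sigma_N\rangle .$$ $\mathrm{PEPS}(\mathcal G)$ is the set of all such states with $\|\Psi\|=1$. *)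

theory Defs
  imports "HOL-Analysis.Analysis"
begin

text \<open>Edges are two-element sets of vertices, so loops at a vertex and parallel edges are excluded.\<close>

definition simple_graph :: "nat \<Rightarrow> nat set set \<Rightarrow> bool" where
  "simple_graph N E \<longleftrightarrow> (\<forall>e\<in>E. e \<subseteq> {1..N} \<and> card e = 2)"

definition connected_graph :: "nat \<Rightarrow> nat set set \<Rightarrow> bool" where
  "connected_graph N E \<longleftrightarrow>
     (\<forall>u\<in>{1..N}. \<forall>v\<in>{1..N}. (u, v) \<in> {(x, y). {x, y} \<in> E}\<^sup>*)"

definition is_cycle :: "nat set set \<Rightarrow> nat list \<Rightarrow> bool" where
  "is_cycle E vs \<longleftrightarrow> length vs \<ge> 3 \<and> distinct vs \<and>
     (\<forall>k<length vs. {vs ! k, vs ! (Suc k mod length vs)} \<in> E)"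

definition incident_edges :: "nat set set \<Rightarrow> nat \<Rightarrow> nat set set" where
  "incident_edges E i = {e \<in> E. i \<in> e}"

definition vertex_degree :: "nat set set \<Rightarrow> nat \<Rightarrow> nat" where
  "vertex_degree E i = card (incident_edges E i)"

text \<open>
  A vector of the tensor product of the spaces \<open>\<complex>\<^bsup>d i\<^esup>\<close> is given by its coefficients in the
  product basis, labelled by the tuples \<open>(\<sigma>\<^sub>1, \<dots>, \<sigma>\<^sub>N)\<close> with \<open>1 \<le> \<sigma>\<^sub>i \<le> d i\<close>; coefficients at
  all other arguments are set to zero.  The product basis is orthonormal, so the Hilbert space norm
  is the Euclidean norm of the coefficient family.
\<close>

definition site_configs :: "nat \<Rightarrow> (nat \<Rightarrow> nat) \<Rightarrow> (nat \<Rightarrow> nat) set" where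
  "site_configs N d = (\<Pi>\<^sub>E i\<in>{1..N}. {1..d i})"

definition tensor_space :: "nat \<Rightarrow> (nat \<Rightarrow> nat) \<Rightarrow> ((nat \<Rightarrow> nat) \<Rightarrow> complex) set" where
  "tensor_space N d = {\<psi>. \<forall>\<sigma>. \<sigma> \<notin> site_configs N d \<longrightarrow> \<psi> \<sigma> = 0}"

definition state_norm :: "nat \<Rightarrow> (nat \<Rightarrow> nat) \<Rightarrow> ((nat \<Rightarrow> nat) \<Rightarrow> complex) \<Rightarrow> real" where
  "state_norm N d \<psi> = L2_set (\<lambda>\<sigma>. cmod (\<psi> \<sigma>)) (site_configs N d)"

definition state_dist ::
  "nat \<Rightarrow> (nat \<Rightarrow> nat) \<Rightarrow> ((nat \<Rightarrow> nat) \<Rightarrow> complex) \<Rightarrow> ((nat \<Rightarrow> nat) \<Rightarrow> complex) \<Rightarrow> real" where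
  "state_dist N d \<psi> \<phi> = state_norm N d (\<lambda>\<sigma>. \<psi> \<sigma> - \<phi> \<sigma>)"

definition norm_topology :: "nat \<Rightarrow> (nat \<Rightarrow> nat) \<Rightarrow> ((nat \<Rightarrow> nat) \<Rightarrow> complex) topology" where
  "norm_topology N d = Metric_space.mtopology (tensor_space N d) (state_dist N d)"

definition bond_configs :: "nat set set \<Rightarrow> (nat set \<Rightarrow> nat) \<Rightarrow> (nat set \<Rightarrow> nat) set" where
  "bond_configs E m = (\<Pi>\<^sub>E e\<in>E. {1..m e})"

text \<open>
  \<open>A i s b\<close> is the entry of the tensor at vertex \<open>i\<close> with physical index \<open>s\<close> and bond indices
  \<open>b\<close>, a family indexed by the edges incident to \<open>i\<close>.  Only entries with all indices
  in range enter the contraction, so the values of \<open>A\<close> elsewhere are immaterial.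
\<close>

definition peps_state ::
  "nat \<Rightarrow> nat set set \<Rightarrow> (nat set \<Rightarrow> nat) \<Rightarrow> (nat \<Rightarrow> nat) \<Rightarrow>
   (nat \<Rightarrow> nat \<Rightarrow> (nat set \<Rightarrow> nat) \<Rightarrow> complex) \<Rightarrow> (nat \<Rightarrow> nat) \<Rightarrow> complex" where
  "peps_state N E m d A = (\<lambda>\<sigma>. if \<sigma> \<in> site_configs N d
     then \<Sum>n\<in>bond_configs E m. \<Prod>i\<in>{1..N}. A i (\<sigma> i) (restrict n (incident_edges E i))
     else 0)"

definition PEPS ::
  "nat \<Rightarrow> nat set set \<Rightarrow> (nat set \<Rightarrow> nat) \<Rightarrow> (nat \<Rightarrow> nat) \<Rightarrow> ((nat \<Rightarrow> nat) \<Rightarrow> complex) set" where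
  "PEPS N E m d = {\<psi>. (\<exists>A. \<psi> = peps_state N E m d A) \<and> state_norm N d \<psi> = 1}"

lemma finite_site_configs: "finite (site_configs N d)"
  unfolding site_configs_def by (intro finite_PiE) auto

lemma Metric_space_tensor_space: "Metric_space (tensor_space N d) (state_dist N d)"
proof
  fix x y z :: "(nat \<Rightarrow> nat) \<Rightarrow> complex"
  show "0 \<le> state_dist N d x y"
    by (simp add: state_dist_def state_norm_def L2_set_nonneg)
  show "state_dist N d x y = state_dist N d y x"
    by (simp add: state_dist_def state_norm_def norm_minus_commute)
  have "state_dist N d x z \<le> L2_set (\<lambda>\<sigma>. cmod (x \<sigma> - y \<sigma>) + cmod (y \<sigma> - z \<sigma>)) (site_configs N d)"
    unfolding state_dist_def state_norm_def
    by (rule L2_set_mono) (auto intro: order_trans[OF _ norm_triangle_ineq])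
  also have "\<dots> \<le> state_dist N d x y + state_dist N d y z"
    unfolding state_dist_def state_norm_def by (rule L2_set_triangle_ineq)
  finally show "state_dist N d x z \<le> state_dist N d x y + state_dist N d y z" .
  assume "x \<in> tensor_space N d" "y \<in> tensor_space N d"
  then show "state_dist N d x y = 0 \<longleftrightarrow> x = y"
    by (auto simp: state_dist_def state_norm_def L2_set_eq_0_iff finite_site_configs
        tensor_space_def fun_eq_iff)
qed

lemma topspace_norm_topology: "topspace (norm_topology N d) = tensor_space N d"
  unfolding norm_topology_def
  by (rule Metric_space.topspace_mtopology[OF Metric_space_tensor_space])

lemma PEPS_subset_tensor_space: "PEPS N E m d \<subseteq> tensor_space N d"
  by (auto simp: PEPS_def peps_state_def tensor_space_def)

end

theory Submission
  imports Defs "Jordan_Normal_Form.Determinant"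
begin

text \<open>
  Let \<open>v\<^sub>0, \<dots>, v\<^bsub>L-1\<^esub>\<close> be a cycle with edges \<open>\<epsilon> k\<close> joining \<open>v\<^sub>k\<close> to its successor.  Since
  \<open>d i \<ge> m^z i\<close>, every vertex can display all of its bond indices in its physical index.  Weight a
  bond configuration by \<open>t\<close> for each vertex \<open>v\<^sub>k\<close>, \<open>k \<ge> 1\<close>, at which the two cycle bonds differ, and
  by \<open>1 / t\<close> if they differ at \<open>v\<^sub>0\<close>.  Going once around the cycle shows that the total exponent is
  nonnegative, so the states converge as \<open>t \<rightarrow> 0\<close> to the uniform superposition \<open>\<Phi>\<close> of the
  configurations of exponent zero.

  Suppose \<open>\<Phi>\<close> were a PEPS with tensors \<open>A\<close>.  Slices of \<open>\<Phi>\<close> produce every basis vector at \<open>v\<^sub>1\<close> and at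
  \<open>v\<^sub>2\<close>, which forces the square matrices \<open>A v\<^sub>1\<close> and \<open>A v\<^sub>2\<close> to be invertible.  Fixing all other
  vertices to display the bond value 1 leaves a matrix of rank one between \<open>v\<^sub>1\<close> and \<open>v\<^sub>2\<close>; undoing
  \<open>A v\<^sub>1\<close> and \<open>A v\<^sub>2\<close> leaves a matrix of rank one of the form \<open>1 \<otimes> B\<close>, where the identity acts on
  the bond \<open>v\<^sub>1v\<^sub>2\<close>.  Its rank is a multiple of \<open>m \<ge> 2\<close>, a contradiction.
\<close>

section \<open>Matrices indexed by a finite set\<close>

text \<open>An enumeration of \<open>I\<close> carries both families to square matrices, for which a
  one-sided inverse over a field is two-sided.\<close>

lemma finite_matrix_left_right_inverse:
  fixes A B :: "'a \<Rightarrow> 'a \<Rightarrow> 'b :: field"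
  assumes "finite I"
    and AB: "\<And>i j. i \<in> I \<Longrightarrow> j \<in> I \<Longrightarrow> (\<Sum>k\<in>I. A i k * B k j) = of_bool (i = j)"
    and "i \<in> I" "j \<in> I"
  shows "(\<Sum>k\<in>I. B i k * A k j) = of_bool (i = j)"
proof -
  obtain h where h: "bij_betw h {0..<card I} I"
    using ex_bij_betw_nat_finite[OF \<open>finite I\<close>] by blast
  define n where "n = card I"
  have h: "bij_betw h {0..<n} I" using h by (simp add: n_def)
  define MA where "MA = mat n n (\<lambda>(p, q). A (h p) (h q))"
  define MB where "MB = mat n n (\<lambda>(p, q). B (h p) (h q))"
  have hI: "h p \<in> I" if "p < n" for p using h that by (auto simp: bij_betw_def)
  have hinj: "h p = h q \<longleftrightarrow> p = q" if "p < n" "q < n" for p q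
    using h that by (intro inj_on_eq_iff[of h "{0..<n}"]) (auto simp: bij_betw_def)
  have "MA * MB = 1\<^sub>m n"
  proof (rule eq_matI)
    fix p q assume "p < dim_row (1\<^sub>m n :: 'b mat)" "q < dim_col (1\<^sub>m n :: 'b mat)"
    then have pq: "p < n" "q < n" by auto
    have "(MA * MB) $$ (p, q) = (\<Sum>k\<in>{0..<n}. A (h p) (h k) * B (h k) (h q))"
      using pq by (simp add: MA_def MB_def scalar_prod_def)
    also have "\<dots> = (\<Sum>k\<in>I. A (h p) k * B k (h q))"
      by (rule sum.reindex_bij_betw[OF h])
    also have "\<dots> = 1\<^sub>m n $$ (p, q)" using pq AB hI hinj by simp
    finally show "(MA * MB) $$ (p, q) = 1\<^sub>m n $$ (p, q)" .
  qed (auto simp: MA_def MB_def)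
  then have BA: "MB * MA = 1\<^sub>m n"
    by (rule mat_mult_left_right_inverse[rotated 2]) (auto simp: MA_def MB_def)
  obtain p q where pq: "p < n" "q < n" "i = h p" "j = h q"
    using h \<open>i \<in> I\<close> \<open>j \<in> I\<close> by (auto simp: bij_betw_def)
  have "(\<Sum>k\<in>I. B i k * A k j) = (\<Sum>k\<in>{0..<n}. B i (h k) * A (h k) j)"
    by (rule sum.reindex_bij_betw[OF h, symmetric])
  also have "\<dots> = (MB * MA) $$ (p, q)"
    using pq by (simp add: MA_def MB_def scalar_prod_def)
  also have "\<dots> = of_bool (i = j)"
    using pq hinj by (simp add: BA)
  finally show ?thesis .
qed

lemma mem_image_iffI:
  assumes "\<And>x'. x' \<in> A \<Longrightarrow> y = f x' \<Longrightarrow> P" "P \<Longrightarrow> y = f x" "x \<in> A"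
  shows "y \<in> f ` A \<longleftrightarrow> P"
  using assms by blast

section \<open>Scaling and limits of PEPS\<close>

text \<open>The contraction is linear in each single tensor, so one vertex can absorb the
  scalar.\<close>

lemma peps_state_scale:
  assumes "j \<in> {1..N}"
  shows "(\<lambda>\<sigma>. c * peps_state N E m d A \<sigma>) = peps_state N E m d (A(j := \<lambda>s b. c * A j s b))"
proof
  fix \<sigma>
  have "(\<Prod>i\<in>{1..N}. (A(j := \<lambda>s b. c * A j s b)) i (\<sigma> i) (restrict n (incident_edges E i)))
     = c * (\<Prod>i\<in>{1..N}. A i (\<sigma> i) (restrict n (incident_edges E i)))" for n
  proof -
    have "(\<Prod>i\<in>{1..N} - {j}. (A(j := \<lambda>s b. c * A j s b)) i (\<sigma> i) (restrict n (incident_edges E i)))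
        = (\<Prod>i\<in>{1..N} - {j}. A i (\<sigma> i) (restrict n (incident_edges E i)))"
      by (rule prod.cong) auto
    then show ?thesis
      using prod.remove[OF _ assms, of "\<lambda>i. (A(j := \<lambda>s b. c * A j s b)) i (\<sigma> i) (restrict n (incident_edges E i))"]
        prod.remove[OF _ assms, of "\<lambda>i. A i (\<sigma> i) (restrict n (incident_edges E i))"]
      by (simp only: finite_atLeastAtMost fun_upd_same mult.assoc)
  qed
  then show "c * peps_state N E m d A \<sigma> = peps_state N E m d (A(j := \<lambda>s b. c * A j s b)) \<sigma>"
    by (simp add: peps_state_def sum_distrib_left)
qed

lemma state_norm_scale: "state_norm N d (\<lambda>\<sigma>. c * \<psi> \<sigma>) = cmod c * state_norm N d \<psi>"
  by (simp add: state_norm_def norm_mult L2_set_right_distrib)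

lemma tendsto_state_norm:
  assumes "\<And>\<sigma>. \<sigma> \<in> site_configs N d \<Longrightarrow> ((\<lambda>t. f t \<sigma>) \<longlongrightarrow> g \<sigma>) F"
  shows "((\<lambda>t. state_norm N d (f t)) \<longlongrightarrow> state_norm N d g) F"
  unfolding state_norm_def L2_set_def
  by (intro tendsto_intros assms)

text \<open>\<open>PEPS\<close> contains unit vectors only, so the sequence and its limit are
  divided by their norms, which converge to a nonzero number. Closedness gives tensors for the
  normalized limit, and the tensor at \<open>j\<close> absorbs the factor
  \<open>\<nu>0\<close>.\<close>

lemma closedin_PEPS_limit:
  fixes A :: "nat \<Rightarrow> nat \<Rightarrow> nat \<Rightarrow> (nat set \<Rightarrow> nat) \<Rightarrow> complex"
  assumes closed: "closedin (norm_topology N d) (PEPS N E m d)"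
    and j: "j \<in> {1..N}"
    and \<psi>: "\<psi> \<in> tensor_space N d" "state_norm N d \<psi> \<noteq> 0"
    and lim: "\<And>\<sigma>. \<sigma> \<in> site_configs N d \<Longrightarrow> (\<lambda>t. peps_state N E m d (A t) \<sigma>) \<longlonglongrightarrow> \<psi> \<sigma>"
  shows "\<exists>B. \<psi> = peps_state N E m d B"
proof -
  interpret Metric_space "tensor_space N d" "state_dist N d"
    by (rule Metric_space_tensor_space)
  define \<nu> where "\<nu> t = state_norm N d (peps_state N E m d (A t))" for t
  define \<nu>0 where "\<nu>0 = state_norm N d \<psi>"
  define \<phi> where "\<phi> t = (\<lambda>\<sigma>. of_real (1 / \<nu> t) * peps_state N E m d (A t) \<sigma>)" for t
  define \<phi>0 where "\<phi>0 = (\<lambda>\<sigma>. of_real (1 / \<nu>0) * \<psi> \<sigma>)"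
  have \<nu>: "\<nu> \<longlonglongrightarrow> \<nu>0" unfolding \<nu>_def \<nu>0_def by (rule tendsto_state_norm[OF lim])
  have \<nu>0: "\<nu>0 > 0" using \<psi>(2) by (simp add: \<nu>0_def state_norm_def L2_set_nonneg less_le)
  have pos: "eventually (\<lambda>t. \<nu> t > 0) sequentially"
    using order_tendstoD(1)[OF \<nu> \<nu>0] .
  have in_PEPS: "eventually (\<lambda>t. \<phi> t \<in> PEPS N E m d) sequentially"
    using pos
  proof eventually_elim
    case (elim t)
    have "\<phi> t = peps_state N E m d ((A t)(j := \<lambda>s b. of_real (1 / \<nu> t) * A t j s b))"
      unfolding \<phi>_def by (rule peps_state_scale[OF j])
    moreover have "state_norm N d (\<phi> t) = 1"
      unfolding \<phi>_def state_norm_scale using elim by (simp add: \<nu>_def norm_divide)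
    ultimately show ?case by (auto simp: PEPS_def)
  qed
  have "(\<lambda>t. state_norm N d (\<lambda>\<sigma>. \<phi> t \<sigma> - \<phi>0 \<sigma>)) \<longlonglongrightarrow> state_norm N d (\<lambda>\<sigma>. \<phi>0 \<sigma> - \<phi>0 \<sigma>)"
    unfolding \<phi>_def \<phi>0_def using \<nu>0
    by (intro tendsto_state_norm tendsto_intros lim \<nu>) auto
  then have "(\<lambda>t. state_dist N d (\<phi> t) \<phi>0) \<longlonglongrightarrow> 0"
    by (simp add: state_dist_def state_norm_def L2_set_def)
  moreover have "\<phi>0 \<in> tensor_space N d"
    using \<psi>(1) by (simp add: \<phi>0_def tensor_space_def)
  moreover have "eventually (\<lambda>t. \<phi> t \<in> tensor_space N d) sequentially"
    using in_PEPS by eventually_elim (use PEPS_subset_tensor_space in blast)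
  ultimately have "limitin (norm_topology N d) \<phi> \<phi>0 sequentially"
    by (simp add: norm_topology_def limitin_metric_dist_null)
  then have "\<phi>0 \<in> PEPS N E m d"
    using limitin_closedin[OF _ closed in_PEPS] by simp
  then obtain B where B: "\<phi>0 = peps_state N E m d B" by (auto simp: PEPS_def)
  have "\<psi> = (\<lambda>\<sigma>. of_real \<nu>0 * \<phi>0 \<sigma>)" using \<nu>0 by (simp add: \<phi>0_def)
  then show ?thesis unfolding B peps_state_scale[OF j] by blast
qed

section \<open>A network with a cycle: configurations and weights\<close>

text \<open>\<open>code i\<close> records all bond indices at vertex \<open>i\<close> in its
  physical index without loss; the bound on \<open>d i\<close> will supply such injections.\<close>

locale cycle_network =
  fixes N m :: nat and E :: "nat set set" and d :: "nat \<Rightarrow> nat" and vs :: "nat list"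
    and code :: "nat \<Rightarrow> (nat set \<Rightarrow> nat) \<Rightarrow> nat"
  assumes m: "m \<ge> 2"
    and simple: "simple_graph N E"
    and cycle: "is_cycle E vs"
    and code_inj: "i \<in> {1..N} \<Longrightarrow> inj_on (code i) (bond_configs (incident_edges E i) (\<lambda>e. m))"
    and code_range: "i \<in> {1..N} \<Longrightarrow> b \<in> bond_configs (incident_edges E i) (\<lambda>e. m) \<Longrightarrow> code i b \<in> {1..d i}"
begin

abbreviation "bonds \<equiv> bond_configs E (\<lambda>e. m)"
abbreviation "inc \<equiv> incident_edges E"
abbreviation "loc i \<equiv> bond_configs (inc i) (\<lambda>e. m)"
abbreviation "L \<equiv> length vs"

definition \<epsilon> :: "nat \<Rightarrow> nat set" where
  "\<epsilon> k = {vs ! k, vs ! (Suc k mod L)}"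

text \<open>Position 0 is left out because the vertex \<open>vs ! 0\<close> contributes with the
  opposite exponent.\<close>

definition jumps :: "(nat set \<Rightarrow> nat) \<Rightarrow> nat set" where
  "jumps n = {k \<in> {1..<L}. n (\<epsilon> (k - 1)) \<noteq> n (\<epsilon> k)}"

text \<open>These are the configurations of total exponent zero, whose weight does not vanish in the
  limit.\<close>

definition good :: "(nat set \<Rightarrow> nat) set" where
  "good = {n \<in> bonds. card (jumps n) = of_bool (n (\<epsilon> 0) \<noteq> n (\<epsilon> (L - 1)))}"

text \<open>The basis label displayed by a bond configuration; each bond value is visible at both
  endpoints of its edge.\<close>

definition obs :: "(nat set \<Rightarrow> nat) \<Rightarrow> nat \<Rightarrow> nat" where
  "obs n = (\<lambda>i\<in>{1..N}. code i (restrict n (inc i)))"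

definition \<Phi> :: "(nat \<Rightarrow> nat) \<Rightarrow> complex" where
  "\<Phi> \<sigma> = of_bool (\<sigma> \<in> obs ` good)"

text \<open>Since \<open>vs\<close> is distinct, at most one factor differs from 1, and vertices off
  the cycle get weight 1. The cycle edges at \<open>vs ! k\<close> are
  \<open>\<epsilon> (k - 1)\<close> and \<open>\<epsilon> k\<close>, those at \<open>vs ! 0\<close>
  are \<open>\<epsilon> (L - 1)\<close> and \<open>\<epsilon> 0\<close>.\<close>

definition weight :: "complex \<Rightarrow> nat \<Rightarrow> (nat set \<Rightarrow> nat) \<Rightarrow> complex" where
  "weight t i b =
     (\<Prod>k\<in>{1..<L}. if vs ! k = i \<and> b (\<epsilon> (k - 1)) \<noteq> b (\<epsilon> k) then t else 1) *
     (if vs ! 0 = i \<and> b (\<epsilon> 0) \<noteq> b (\<epsilon> (L - 1)) then 1 / t else 1)"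

lemma L3: "L \<ge> 3" and distinct_vs: "distinct vs"
  using cycle by (auto simp: is_cycle_def)

lemma L_gt: "0 < L" "1 < L" "2 < L"
  using L3 by linarith+

lemma vs_eq_iff: "k < L \<Longrightarrow> l < L \<Longrightarrow> vs ! k = vs ! l \<longleftrightarrow> k = l"
  using distinct_vs by (simp add: nth_eq_iff_index_eq)

lemma \<epsilon>_in: "k < L \<Longrightarrow> \<epsilon> k \<in> E"
  using cycle by (auto simp: is_cycle_def \<epsilon>_def)

lemma edge_range: "e \<in> E \<Longrightarrow> e \<subseteq> {1..N}" and edge_card: "e \<in> E \<Longrightarrow> card e = 2"
  using simple by (auto simp: simple_graph_def)

lemma finite_E: "finite E"
  by (rule finite_subset[of _ "Pow {1..N}"]) (use edge_range in auto)

lemma finite_bonds: "finite bonds"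
  unfolding bond_configs_def by (intro finite_PiE finite_E) auto

lemma finite_loc: "finite (loc i)"
  unfolding bond_configs_def
  by (intro finite_PiE finite_subset[OF _ finite_E]) (auto simp: incident_edges_def)

lemma vs_range: "k < L \<Longrightarrow> vs ! k \<in> {1..N}"
  using edge_range[OF \<epsilon>_in[of k]] by (auto simp: \<epsilon>_def)

lemma \<epsilon>_inc: "k < L \<Longrightarrow> \<epsilon> k \<in> inc (vs ! k)"
  using \<epsilon>_in by (auto simp: incident_edges_def \<epsilon>_def)

lemma \<epsilon>_inc_pred: "1 \<le> k \<Longrightarrow> k < L \<Longrightarrow> \<epsilon> (k - 1) \<in> inc (vs ! k)"
  using \<epsilon>_in[of "k - 1"] by (auto simp: incident_edges_def \<epsilon>_def)

lemma \<epsilon>_inc_last: "\<epsilon> (L - 1) \<in> inc (vs ! 0)"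
proof -
  have "Suc (L - 1) = L" using L3 by simp
  then show ?thesis using \<epsilon>_in[of "L - 1"] L3 by (simp add: incident_edges_def \<epsilon>_def)
qed

lemma restrict_bonds: "n \<in> bonds \<Longrightarrow> restrict n (inc i) \<in> loc i"
  by (auto simp: bond_configs_def incident_edges_def)

lemma obs_in: "n \<in> bonds \<Longrightarrow> obs n \<in> site_configs N d"
  using code_range restrict_bonds by (auto simp: obs_def site_configs_def)

lemma bonds_eqI:
  assumes n: "n \<in> bonds" "n' \<in> bonds" and "i \<in> {1..N}" "obs n i = obs n' i" "e \<in> E" "i \<in> e"
  shows "n e = n' e"
proof -
  have "restrict n (inc i) = restrict n' (inc i)"
    using assms inj_onD[OF code_inj[OF \<open>i \<in> {1..N}\<close>]] restrict_bonds by (simp add: obs_def)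
  then have "restrict n (inc i) e = restrict n' (inc i) e" by simp
  with assms show ?thesis by (simp add: incident_edges_def)
qed

lemma bonds_ext: "n \<in> bonds \<Longrightarrow> n' \<in> bonds \<Longrightarrow> (\<And>e. e \<in> E \<Longrightarrow> n e = n' e) \<Longrightarrow> n = n'"
  unfolding bond_configs_def by (rule PiE_ext)

text \<open>Every edge has an endpoint other than \<open>u\<close>, and that endpoint displays its
  bond value.\<close>

lemma obs_off_vertex:
  assumes n: "n \<in> bonds" "n' \<in> bonds" and eq: "\<And>i. i \<in> {1..N} \<Longrightarrow> i \<noteq> u \<Longrightarrow> obs n i = obs n' i"
  shows "n = n'"
proof (rule bonds_ext[OF n])
  fix e assume e: "e \<in> E"
  obtain i where "i \<in> e" "i \<noteq> u"
    using edge_card[OF e] by (auto simp: card_2_iff)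
  then show "n e = n' e"
    using edge_range[OF e] e n eq by (intro bonds_eqI[of n n' i]) auto
qed

lemma inj_obs: "inj_on obs bonds"
  \<comment> \<open>0 is not a vertex, so nothing is exempted.\<close>
  by (rule inj_onI, rule obs_off_vertex[of _ _ 0]) auto

section \<open>The weighted states and their limit\<close>

text \<open>Without jumps the bond value is constant from \<open>\<epsilon> 0\<close> to
  \<open>\<epsilon> (L - 1)\<close>. Hence the factor \<open>1 / t\<close> at \<open>vs ! 0\<close>
  is always compensated by some factor \<open>t\<close>.\<close>

lemma jumps_nonempty:
  assumes "n (\<epsilon> 0) \<noteq> n (\<epsilon> (L - 1))"
  shows "jumps n \<noteq> {}"
proof
  assume none: "jumps n = {}"
  have "k < L \<Longrightarrow> n (\<epsilon> k) = n (\<epsilon> 0)" for k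
  proof (induction k)
    case (Suc k)
    have "Suc k \<notin> jumps n" using none by simp
    with Suc show ?case by (auto simp: jumps_def)
  qed simp
  from this[of "L - 1"] show False using assms L3 by simp
qed

lemma prod_weight:
  assumes "n \<in> bonds"
  shows "(\<Prod>i\<in>{1..N}. weight t i (restrict n (inc i)))
     = t ^ card (jumps n) * (if n (\<epsilon> 0) \<noteq> n (\<epsilon> (L - 1)) then 1 / t else 1)"
proof -
  \<comment> \<open>Once the products over vertices and cycle positions are exchanged, each position
    contributes at one vertex only.\<close>
  have single: "(\<Prod>i\<in>{1..N}. if vs ! k = i \<and> P i then x else 1) = (if P (vs ! k) then x else 1)"
    if "k < L" for k P and x :: complex
  proof -
    have "(\<Prod>i\<in>{1..N}. if vs ! k = i \<and> P i then x else 1)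
        = (\<Prod>i\<in>{1..N}. if vs ! k = i then (if P i then x else 1) else 1)"
      by (rule prod.cong) auto
    also have "\<dots> = (if P (vs ! k) then x else 1)"
      using vs_range[OF that] by (subst prod.delta') auto
    finally show ?thesis .
  qed
  have "(\<Prod>i\<in>{1..N}. \<Prod>k\<in>{1..<L}. if vs ! k = i \<and> restrict n (inc i) (\<epsilon> (k - 1)) \<noteq> restrict n (inc i) (\<epsilon> k) then t else 1)
      = (\<Prod>k\<in>{1..<L}. if n (\<epsilon> (k - 1)) \<noteq> n (\<epsilon> k) then t else 1)"
    by (subst prod.swap, rule prod.cong[OF refl], subst single)
       (auto simp: \<epsilon>_inc \<epsilon>_inc_pred[simplified])
  also have "\<dots> = t ^ card (jumps n)"
    unfolding jumps_def by (subst prod.inter_filter[symmetric]) auto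
  finally have 1: "(\<Prod>i\<in>{1..N}. \<Prod>k\<in>{1..<L}. if vs ! k = i \<and> restrict n (inc i) (\<epsilon> (k - 1)) \<noteq> restrict n (inc i) (\<epsilon> k) then t else 1) = t ^ card (jumps n)" .
  have 2: "(\<Prod>i\<in>{1..N}. if vs ! 0 = i \<and> restrict n (inc i) (\<epsilon> 0) \<noteq> restrict n (inc i) (\<epsilon> (L - 1)) then 1 / t else 1)
     = (if n (\<epsilon> 0) \<noteq> n (\<epsilon> (L - 1)) then 1 / t else 1)"
    using \<epsilon>_inc[OF L_gt(1)] \<epsilon>_inc_last by (subst single[OF L_gt(1)]) simp_all
  show ?thesis unfolding weight_def prod.distrib 1 2 ..
qed

definition approx :: "complex \<Rightarrow> nat \<Rightarrow> nat \<Rightarrow> (nat set \<Rightarrow> nat) \<Rightarrow> complex" where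
  "approx t i s b = of_bool (s = code i b) * weight t i b"

text \<open>The subtraction of naturals loses nothing: by \<open>jumps_nonempty\<close> the
  subtrahend never exceeds \<open>card (jumps n)\<close>.\<close>

lemma peps_state_approx:
  assumes "\<sigma> \<in> site_configs N d" "t \<noteq> 0"
  shows "peps_state N E (\<lambda>e. m) d (approx t) \<sigma>
     = (\<Sum>n\<in>bonds. of_bool (\<sigma> = obs n) * t ^ (card (jumps n) - of_bool (n (\<epsilon> 0) \<noteq> n (\<epsilon> (L - 1)))))"
proof -
  have "(\<Prod>i\<in>{1..N}. approx t i (\<sigma> i) (restrict n (inc i)))
      = of_bool (\<sigma> = obs n) * t ^ (card (jumps n) - of_bool (n (\<epsilon> 0) \<noteq> n (\<epsilon> (L - 1))))"
    if n: "n \<in> bonds" for n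
  proof -
    have "\<sigma> = obs n \<longleftrightarrow> (\<forall>i\<in>{1..N}. \<sigma> i = code i (restrict n (inc i)))"
      using assms(1) by (auto simp: obs_def site_configs_def PiE_def extensional_def fun_eq_iff)
    then have 1: "(\<Prod>i\<in>{1..N}. of_bool (\<sigma> i = code i (restrict n (inc i))) :: complex) = of_bool (\<sigma> = obs n)"
      by (cases "\<sigma> = obs n") (auto intro!: prod_zero)
    have 2: "t ^ card (jumps n) * (if n (\<epsilon> 0) \<noteq> n (\<epsilon> (L - 1)) then 1 / t else 1)
        = t ^ (card (jumps n) - of_bool (n (\<epsilon> 0) \<noteq> n (\<epsilon> (L - 1))))"
    proof (cases "n (\<epsilon> 0) \<noteq> n (\<epsilon> (L - 1))")
      case True
      have "finite (jumps n)" by (simp add: jumps_def)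
      then have "card (jumps n) > 0" using jumps_nonempty[of n] True by (simp add: card_gt_0_iff)
      then show ?thesis using True \<open>t \<noteq> 0\<close> by (cases "card (jumps n)") auto
    qed auto
    show ?thesis
      unfolding approx_def prod.distrib 1 prod_weight[OF n] 2 ..
  qed
  then show ?thesis using assms(1) by (simp add: peps_state_def)
qed

text \<open>A power of \<open>t\<close> tends to 1 or 0 according to whether its exponent is zero.
  By injectivity of \<open>obs\<close>, at most one configuration contributes to a given
  coefficient.\<close>

lemma approx_limit:
  assumes "\<sigma> \<in> site_configs N d"
  shows "(\<lambda>k. peps_state N E (\<lambda>e. m) d (approx (1 / of_nat (Suc k))) \<sigma>) \<longlonglongrightarrow> \<Phi> \<sigma>"
proof -
  define x where "x n = card (jumps n) - of_bool (n (\<epsilon> 0) \<noteq> n (\<epsilon> (L - 1)))" for n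
  have x: "x n = 0 \<longleftrightarrow> n \<in> good" if "n \<in> bonds" for n
  proof -
    have "finite (jumps n)" by (simp add: jumps_def)
    then have "n (\<epsilon> 0) \<noteq> n (\<epsilon> (L - 1)) \<longrightarrow> card (jumps n) > 0"
      using jumps_nonempty[of n] by (simp add: card_gt_0_iff)
    then show ?thesis using that by (auto simp: x_def good_def)
  qed
  have lim0: "(\<lambda>k. 1 / of_nat (Suc k) :: complex) \<longlonglongrightarrow> 0"
    using lim_1_over_n[where 'a = complex] LIMSEQ_Suc by blast
  have pw: "(\<lambda>k. (1 / of_nat (Suc k) :: complex) ^ x n) \<longlonglongrightarrow> of_bool (n \<in> good)" if "n \<in> bonds" for n
  proof (cases "n \<in> good")
    case False
    then have "x n > 0" using x[OF that] by simp
    with tendsto_power[OF lim0, of "x n"] False show ?thesis by (simp add: zero_power)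
  qed (use x[OF that] in simp)
  have "(\<Sum>n\<in>bonds. of_bool (\<sigma> = obs n) * of_bool (n \<in> good) :: complex) = \<Phi> \<sigma>"
  proof (cases "\<sigma> \<in> obs ` bonds")
    case True
    then obtain n0 where n0: "n0 \<in> bonds" "\<sigma> = obs n0" by blast
    have "good \<subseteq> bonds" by (auto simp: good_def)
    then have "\<sigma> \<in> obs ` good \<longleftrightarrow> n0 \<in> good"
      using n0 inj_obs by (auto simp: inj_on_def)
    moreover have "(\<Sum>n\<in>bonds. of_bool (\<sigma> = obs n) * of_bool (n \<in> good) :: complex)
        = (\<Sum>n\<in>bonds. if n = n0 then of_bool (n \<in> good) else 0)"
      using n0 inj_obs by (intro sum.cong) (auto simp: inj_on_def)
    ultimately show ?thesis using n0 finite_bonds by (simp add: \<Phi>_def)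
  next
    case False
    then have "(\<Sum>n\<in>bonds. of_bool (\<sigma> = obs n) * of_bool (n \<in> good) :: complex) = 0"
      by (intro sum.neutral) auto
    moreover have "\<sigma> \<notin> obs ` good" using False by (auto simp: good_def)
    ultimately show ?thesis by (simp add: \<Phi>_def)
  qed
  moreover have "(\<lambda>k. \<Sum>n\<in>bonds. of_bool (\<sigma> = obs n) * (1 / of_nat (Suc k) :: complex) ^ x n)
      \<longlonglongrightarrow> (\<Sum>n\<in>bonds. of_bool (\<sigma> = obs n) * of_bool (n \<in> good))"
    by (intro tendsto_sum tendsto_mult tendsto_const pw)
  moreover have "peps_state N E (\<lambda>e. m) d (approx (1 / of_nat (Suc k))) \<sigma>
      = (\<Sum>n\<in>bonds. of_bool (\<sigma> = obs n) * (1 / of_nat (Suc k) :: complex) ^ x n)" for k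
    unfolding x_def by (rule peps_state_approx[OF assms]) (simp del: of_nat_Suc)
  ultimately show ?thesis by simp
qed

section \<open>Invertibility of the tensors on the cycle\<close>

text \<open>The vertices of the cycle are distinct, so \<open>vs ! k\<close> is an endpoint of no
  other cycle edge; \<open>1 \<le> k\<close> excludes the wrap-around.\<close>

lemma \<epsilon>_off_vertex:
  assumes "1 \<le> k" "k < L" "j < L" "\<epsilon> j \<in> inc (vs ! k)"
  shows "j = k - 1 \<or> j = k"
proof -
  have "vs ! k = vs ! j \<or> vs ! k = vs ! (Suc j mod L)"
    using assms(4) by (auto simp: incident_edges_def \<epsilon>_def)
  then have "k = j \<or> k = Suc j mod L"
    using assms vs_eq_iff[of k j] vs_eq_iff[of k "Suc j mod L"] mod_less_divisor[OF L_gt(1), of "Suc j"]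
    by blast
  then show ?thesis using assms by (cases "Suc j = L") auto
qed

text \<open>Incidence leaves only the coincidence of \<open>\<epsilon> 0\<close> with
  \<open>\<epsilon> 1\<close>, which three distinct vertices exclude.\<close>

lemma \<epsilon>_inj:
  assumes "i < L" "j < L" "i < j"
  shows "\<epsilon> i \<noteq> \<epsilon> j"
proof
  assume eq: "\<epsilon> i = \<epsilon> j"
  have "\<epsilon> i \<in> inc (vs ! j)" unfolding eq using \<epsilon>_inc assms by simp
  then have i: "i = j - 1" using \<epsilon>_off_vertex[of j i] assms by auto
  have "\<epsilon> j \<in> inc (vs ! i)" unfolding eq[symmetric] using \<epsilon>_inc assms by simp
  then have "i = 0" using \<epsilon>_off_vertex[of i j] assms by (cases "i = 0") auto
  then have "j = 1" using i assms by auto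
  have "Suc 0 mod L = 1" "Suc 1 mod L = 2" using L3 by simp_all
  then have "{vs ! 0, vs ! 1} = {vs ! 1, vs ! 2}"
    using eq unfolding \<open>i = 0\<close> \<open>j = 1\<close> \<epsilon>_def by metis
  then have "vs ! 2 \<in> {vs ! 0, vs ! 1}" by blast
  then show False using vs_eq_iff[OF L_gt(3,1)] vs_eq_iff[OF L_gt(3,2)] by simp
qed

text \<open>At \<open>v\<^sub>k\<close> with \<open>k \<ge> 1\<close> any local values are allowed: the one jump at \<open>v\<^sub>k\<close> is paid for at \<open>v\<^sub>0\<close>.\<close>

lemma good_extension:
  assumes k: "1 \<le> k" "k < L" and b: "b \<in> loc (vs ! k)"
  shows "\<exists>n\<in>good. restrict n (inc (vs ! k)) = b"
proof -
  \<comment> \<open>One constant value along the cycle before \<open>vs ! k\<close> and another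
    after it, so that the cycle changes value at most at \<open>vs ! k\<close> and at
    \<open>vs ! 0\<close>. The value on edges off the cycle and away from \<open>vs ! k\<close> is
    arbitrary.\<close>
  define n where "n = (\<lambda>e\<in>E. if e \<in> inc (vs ! k) then b e
    else if e \<in> \<epsilon> ` {..<k} then b (\<epsilon> (k - 1)) else b (\<epsilon> k))"
  have br: "b e \<in> {1..m}" if "e \<in> inc (vs ! k)" for e
    using b that unfolding bond_configs_def by (rule PiE_mem)
  have n: "n \<in> bonds"
    unfolding bond_configs_def n_def using br \<epsilon>_inc[OF k(2)] \<epsilon>_inc_pred[OF k] by auto
  have res: "restrict n (inc (vs ! k)) = b"
    using b by (auto simp: n_def bond_configs_def incident_edges_def fun_eq_iff PiE_def extensional_def)
  have val: "n (\<epsilon> j) = (if j < k then b (\<epsilon> (k - 1)) else b (\<epsilon> k))" if "j < L" for j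
  proof (cases "\<epsilon> j \<in> inc (vs ! k)")
    case True
    then show ?thesis using \<epsilon>_off_vertex[OF k that] \<epsilon>_in[OF that] k by (auto simp: n_def)
  next
    case False
    have "j < k" if img: "\<epsilon> j \<in> \<epsilon> ` {..<k}"
    proof (rule ccontr)
      assume "\<not> j < k"
      moreover obtain i where i: "i < k" "\<epsilon> j = \<epsilon> i" using img by auto
      ultimately show False using \<epsilon>_inj[of i j] k \<open>j < L\<close> by auto
    qed
    then show ?thesis using False \<epsilon>_in[OF that] by (auto simp: n_def)
  qed
  have "jumps n = (if b (\<epsilon> (k - 1)) = b (\<epsilon> k) then {} else {k})"
    using k by (auto simp: jumps_def val split: if_splits)
  moreover have "n (\<epsilon> 0) = b (\<epsilon> (k - 1))" "n (\<epsilon> (L - 1)) = b (\<epsilon> k)"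
  proof -
    have "L - 1 < L" "\<not> L - 1 < k" "0 < k" using k by linarith+
    then show "n (\<epsilon> 0) = b (\<epsilon> (k - 1))" "n (\<epsilon> (L - 1)) = b (\<epsilon> k)"
      using val[OF L_gt(1)] val[of "L - 1"] by (simp_all only: if_True if_False)
  qed
  ultimately have "n \<in> good"
    using n by (simp add: good_def)
  then show ?thesis using res by blast
qed

text \<open>The display at the other vertices already determines \<open>n\<close>, so only one value
  at \<open>u\<close> gives a nonzero coefficient.\<close>

lemma \<Phi>_off_vertex:
  assumes "n \<in> good" and u: "u \<in> {1..N}" and b: "b \<in> loc u"
  shows "\<Phi> ((obs n)(u := code u b)) = of_bool (b = restrict n (inc u))"
proof -
  have nb: "n \<in> bonds" using assms by (simp add: good_def)
  have "b = restrict n (inc u)" if n': "n' \<in> good" "(obs n)(u := code u b) = obs n'" for n'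
  proof -
    have n'b: "n' \<in> bonds" using n' by (simp add: good_def)
    have "n = n'"
      by (rule obs_off_vertex[OF nb n'b, of u]) (use n'(2) in \<open>auto simp: fun_eq_iff split: if_splits\<close>)
    then have "code u b = obs n u" using fun_cong[OF n'(2), of u] by simp
    then show ?thesis
      using u b restrict_bonds[OF nb] inj_onD[OF code_inj[OF u]] by (simp add: obs_def)
  qed
  moreover have "(obs n)(u := code u b) = obs n" if "b = restrict n (inc u)"
    using u by (simp add: obs_def that fun_eq_iff)
  ultimately have "(obs n)(u := code u b) \<in> obs ` good \<longleftrightarrow> b = restrict n (inc u)"
    using assms(1) by (rule mem_image_iffI)
  then show ?thesis by (simp add: \<Phi>_def)
qed

lemma obs_update_in:
  "\<sigma> \<in> site_configs N d \<Longrightarrow> u \<in> {1..N} \<Longrightarrow> b \<in> loc u \<Longrightarrow> \<sigma>(u := code u b) \<in> site_configs N d"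
  using code_range[of u b] by (auto simp: site_configs_def PiE_def extensional_def Pi_def)

text \<open>Restricted to the physical values in the image of \<open>code\<close>, the tensor is a
  square matrix. Slices of \<open>\<Phi>\<close> give it a right inverse, which is then also a left
  inverse.\<close>

lemma vertex_tensor_invertible:
  assumes \<Phi>: "\<Phi> = peps_state N E (\<lambda>e. m) d A" and k: "1 \<le> k" "k < L"
  obtains R where
    "\<And>b b'. b \<in> loc (vs ! k) \<Longrightarrow> b' \<in> loc (vs ! k) \<Longrightarrow>
       (\<Sum>c\<in>loc (vs ! k). A (vs ! k) (code (vs ! k) b) c * R c b') = of_bool (b = b')"
    "\<And>b b'. b \<in> loc (vs ! k) \<Longrightarrow> b' \<in> loc (vs ! k) \<Longrightarrow>
       (\<Sum>c\<in>loc (vs ! k). R b c * A (vs ! k) (code (vs ! k) c) b') = of_bool (b = b')"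
proof -
  define u where "u = vs ! k"
  have u: "u \<in> {1..N}" using vs_range k by (simp add: u_def)
  obtain ext where ext: "\<And>b. b \<in> loc u \<Longrightarrow> ext b \<in> good \<and> restrict (ext b) (inc u) = b"
    using good_extension[OF k] unfolding u_def by metis
  \<comment> \<open>The contraction of all other vertices, displaying \<open>ext b\<close>, with the
    bonds at \<open>u\<close> held at \<open>c\<close>.\<close>
  define R where "R c b = (\<Sum>n | n \<in> bonds \<and> restrict n (inc u) = c.
      \<Prod>i\<in>{1..N} - {u}. A i (obs (ext b) i) (restrict n (inc i)))" for c b
  have right: "(\<Sum>c\<in>loc u. A u (code u b) c * R c b') = of_bool (b = b')"
    if b: "b \<in> loc u" and b': "b' \<in> loc u" for b b'
  proof -
    define \<sigma> where "\<sigma> = (obs (ext b'))(u := code u b)"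
    have \<sigma>: "\<sigma> \<in> site_configs N d"
      unfolding \<sigma>_def using ext[OF b'] b u by (intro obs_update_in obs_in) (auto simp: good_def)
    have "of_bool (b = b') = \<Phi> \<sigma>"
      unfolding \<sigma>_def using \<Phi>_off_vertex[OF _ u b, of "ext b'"] ext[OF b'] by simp
    also have "\<dots> = (\<Sum>n\<in>bonds. \<Prod>i\<in>{1..N}. A i (\<sigma> i) (restrict n (inc i)))"
      unfolding \<Phi> using \<sigma> by (simp add: peps_state_def)
    also have "\<dots> = (\<Sum>n\<in>bonds. A u (code u b) (restrict n (inc u)) *
        (\<Prod>i\<in>{1..N} - {u}. A i (obs (ext b') i) (restrict n (inc i))))"
    proof (rule sum.cong[OF refl])
      fix n
      show "(\<Prod>i\<in>{1..N}. A i (\<sigma> i) (restrict n (inc i))) = A u (code u b) (restrict n (inc u)) *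
        (\<Prod>i\<in>{1..N} - {u}. A i (obs (ext b') i) (restrict n (inc i)))"
        by (subst prod.remove[OF _ u]) (auto simp: \<sigma>_def)
    qed
    also have "\<dots> = (\<Sum>c\<in>loc u. \<Sum>n | n \<in> bonds \<and> restrict n (inc u) = c.
        A u (code u b) (restrict n (inc u)) *
        (\<Prod>i\<in>{1..N} - {u}. A i (obs (ext b') i) (restrict n (inc i))))"
      by (rule sum.group[symmetric]) (use finite_bonds finite_loc restrict_bonds in auto)
    also have "\<dots> = (\<Sum>c\<in>loc u. A u (code u b) c * R c b')"
      unfolding R_def sum_distrib_left by (intro sum.cong refl) auto
    finally show ?thesis ..
  qed
  have left: "(\<Sum>c\<in>loc u. R b c * A u (code u c) b') = of_bool (b = b')"
    if "b \<in> loc u" "b' \<in> loc u" for b b'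
    using finite_matrix_left_right_inverse[OF finite_loc right that] .
  show ?thesis using that right left unfolding u_def by blast
qed

section \<open>The slice between two neighbours on the cycle\<close>

definition ones :: "nat set \<Rightarrow> nat" where
  "ones = (\<lambda>e\<in>E. 1)"

lemma ones_good: "ones \<in> good"
proof -
  have "ones (\<epsilon> k) = 1" if "k < L" for k using \<epsilon>_in[OF that] by (simp add: ones_def)
  then have "jumps ones = {}" "ones (\<epsilon> 0) = ones (\<epsilon> (L - 1))"
    using L_gt by (auto simp: jumps_def)
  moreover have "ones \<in> bonds" using m by (auto simp: ones_def bond_configs_def)
  ultimately show ?thesis by (simp add: good_def)
qed

lemma \<epsilon>1: "\<epsilon> 1 = {vs ! 1, vs ! 2}"
  using L3 by (simp add: \<epsilon>_def numeral_2_eq_2)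

lemma neighbours_distinct: "vs ! 1 \<noteq> vs ! 2"
  using L3 vs_eq_iff[of 1 2] by simp

text \<open>In a simple graph no second edge joins \<open>vs ! 1\<close> and
  \<open>vs ! 2\<close>.\<close>

lemma endpoint_off_edge:
  assumes "e \<in> E" "e \<noteq> \<epsilon> 1"
  shows "\<exists>i\<in>e. i \<noteq> vs ! 1 \<and> i \<noteq> vs ! 2"
proof (rule ccontr)
  assume "\<not> ?thesis"
  then have "e \<subseteq> \<epsilon> 1" unfolding \<epsilon>1 by blast
  moreover have "card e = card (\<epsilon> 1)" using assms edge_card \<epsilon>_in[OF L_gt(2)] by simp
  ultimately have "e = \<epsilon> 1" by (intro card_subset_eq) (simp_all only: \<epsilon>1 finite.intros)
  with assms show False by simp
qed

text \<open>The other vertices force every bond except \<open>\<epsilon> 1\<close> to be 1. Another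
  value there would cause jumps at both \<open>vs ! 1\<close> and \<open>vs ! 2\<close>, and a good
  configuration has at most one. So the slice has a single nonzero entry and rank one.\<close>

lemma \<Phi>_slice:
  assumes b: "b \<in> loc (vs ! 1)" and b': "b' \<in> loc (vs ! 2)"
  shows "\<Phi> ((obs ones)(vs ! 1 := code (vs ! 1) b, vs ! 2 := code (vs ! 2) b'))
    = of_bool (b = restrict ones (inc (vs ! 1))) * of_bool (b' = restrict ones (inc (vs ! 2)))"
proof -
  let ?u = "vs ! 1" and ?v = "vs ! 2"
  let ?\<sigma> = "(obs ones)(?u := code ?u b, ?v := code ?v b')"
  have u: "?u \<in> {1..N}" and v: "?v \<in> {1..N}" using vs_range[of 1] vs_range[of 2] L3 by auto
  have ob: "ones \<in> bonds" using ones_good by (simp add: good_def)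
  have "b = restrict ones (inc ?u) \<and> b' = restrict ones (inc ?v)"
    if n: "n \<in> good" "?\<sigma> = obs n" for n
  proof -
    have nb: "n \<in> bonds" using n by (simp add: good_def)
    have off: "n e = ones e" if e: "e \<in> E" "e \<noteq> \<epsilon> 1" for e
    proof -
      obtain i where i: "i \<in> e" "i \<noteq> ?u" "i \<noteq> ?v" using endpoint_off_edge[OF e] by blast
      then have "obs n i = obs ones i" using fun_cong[OF n(2), of i] by simp
      then show ?thesis using i edge_range[OF e(1)] e nb ob by (intro bonds_eqI[of n ones i]) auto
    qed
    have "(0 :: nat) < 1" "(1 :: nat) < 2" by simp_all
    then have "n (\<epsilon> 0) = ones (\<epsilon> 0) \<and> n (\<epsilon> 2) = ones (\<epsilon> 2)"
      using off[OF \<epsilon>_in[OF L_gt(1)]] off[OF \<epsilon>_in[OF L_gt(3)]]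
        \<epsilon>_inj[OF L_gt(1,2)] \<epsilon>_inj[OF L_gt(2,3)]
      by metis
    then have ends: "n (\<epsilon> 0) = 1" "n (\<epsilon> 2) = 1"
      using \<epsilon>_in[OF L_gt(1)] \<epsilon>_in[OF L_gt(3)] by (simp_all add: ones_def)
    have "n (\<epsilon> 1) = 1"
    proof (rule ccontr)
      assume "n (\<epsilon> 1) \<noteq> 1"
      then have "{1, 2} \<subseteq> jumps n" using ends L3 by (auto simp: jumps_def)
      moreover have "finite (jumps n)" by (simp add: jumps_def)
      ultimately have "card {1::nat, 2} \<le> card (jumps n)" by (rule card_mono[rotated])
      moreover have "card (jumps n) \<le> 1" using n(1) by (auto simp: good_def)
      ultimately show False by simp
    qed
    then have "n = ones"
      using \<epsilon>_in[of 1] L3 off by (intro bonds_ext[OF nb ob]) (auto simp: ones_def)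
    then have "code ?u b = obs ones ?u" "code ?v b' = obs ones ?v"
      using fun_cong[OF n(2), of ?u] fun_cong[OF n(2), of ?v] neighbours_distinct by auto
    then show ?thesis
      using u v b b' restrict_bonds[OF ob] inj_onD[OF code_inj[OF u]] inj_onD[OF code_inj[OF v]]
      by (simp add: obs_def)
  qed
  moreover have "?\<sigma> = obs ones" if "b = restrict ones (inc ?u)" "b' = restrict ones (inc ?v)"
    using u v by (auto simp: obs_def that fun_eq_iff)
  ultimately have "?\<sigma> \<in> obs ` good \<longleftrightarrow> b = restrict ones (inc ?u) \<and> b' = restrict ones (inc ?v)"
    using ones_good by (intro mem_image_iffI[where x = ones]) blast+
  then show ?thesis by (simp add: \<Phi>_def)
qed

theorem \<Phi>_not_peps_state: "\<Phi> \<noteq> peps_state N E (\<lambda>e. m) d A"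
proof
  assume \<Phi>: "\<Phi> = peps_state N E (\<lambda>e. m) d A"
  define u v e where "u = vs ! 1" and "v = vs ! 2" and "e = \<epsilon> 1"
  have u: "u \<in> {1..N}" and v: "v \<in> {1..N}"
    using vs_range[of 1] vs_range[of 2] L3 by (auto simp: u_def v_def)
  have uv: "u \<noteq> v" using neighbours_distinct by (simp add: u_def v_def)
  have e: "e = {u, v}" "e \<in> E" using \<epsilon>1 \<epsilon>_in[of 1] L3 by (auto simp: e_def u_def v_def)
  have einc: "e \<in> inc u" "e \<in> inc v" using e by (auto simp: incident_edges_def)
  have ob: "ones \<in> bonds" using ones_good by (simp add: good_def)
  obtain R where
    R_right: "\<And>b b'. b \<in> loc u \<Longrightarrow> b' \<in> loc u \<Longrightarrow> (\<Sum>c\<in>loc u. A u (code u b) c * R c b') = of_bool (b = b')"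
    and R_left: "\<And>b b'. b \<in> loc u \<Longrightarrow> b' \<in> loc u \<Longrightarrow> (\<Sum>c\<in>loc u. R b c * A u (code u c) b') = of_bool (b = b')"
    using vertex_tensor_invertible[OF \<Phi>, of 1] L3 unfolding u_def by auto
  obtain S where
    S_right: "\<And>b b'. b \<in> loc v \<Longrightarrow> b' \<in> loc v \<Longrightarrow> (\<Sum>c\<in>loc v. A v (code v b) c * S c b') = of_bool (b = b')"
    and S_left: "\<And>b b'. b \<in> loc v \<Longrightarrow> b' \<in> loc v \<Longrightarrow> (\<Sum>c\<in>loc v. S b c * A v (code v c) b') = of_bool (b = b')"
    using vertex_tensor_invertible[OF \<Phi>, of 2] L3 unfolding v_def by auto
  define ou where "ou = restrict ones (inc u)"
  define ov where "ov = restrict ones (inc v)"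
  have ou: "ou \<in> loc u" and ov: "ov \<in> loc v" using restrict_bonds[OF ob] by (auto simp: ou_def ov_def)
  \<comment> \<open>The environment of \<open>u\<close> and \<open>v\<close>; \<open>D\<close> sums
    it over the configurations with prescribed bonds at both.\<close>
  define W where "W n = (\<Prod>i\<in>{1..N} - {u} - {v}. A i (obs ones i) (restrict n (inc i)))" for n
  define D where "D \<beta> \<gamma> = (\<Sum>n | n \<in> bonds \<and> restrict n (inc u) = \<beta> \<and> restrict n (inc v) = \<gamma>. W n)" for \<beta> \<gamma>
  have slice: "(\<Sum>n\<in>bonds. A u (code u b) (restrict n (inc u)) * A v (code v b') (restrict n (inc v)) * W n)
      = of_bool (b = ou) * of_bool (b' = ov)" if b: "b \<in> loc u" and b': "b' \<in> loc v" for b b'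
  proof -
    let ?\<sigma> = "(obs ones)(u := code u b, v := code v b')"
    have \<sigma>: "?\<sigma> \<in> site_configs N d"
      using b b' u v by (intro obs_update_in obs_in ob)
    have "of_bool (b = ou) * of_bool (b' = ov) = \<Phi> ?\<sigma>"
      using \<Phi>_slice b b' unfolding u_def v_def ou_def ov_def by simp
    also have "\<dots> = (\<Sum>n\<in>bonds. \<Prod>i\<in>{1..N}. A i (?\<sigma> i) (restrict n (inc i)))"
      unfolding \<Phi> using \<sigma> by (simp add: peps_state_def)
    also have "\<dots> = (\<Sum>n\<in>bonds. A u (code u b) (restrict n (inc u)) * A v (code v b') (restrict n (inc v)) * W n)"
    proof (rule sum.cong[OF refl])
      fix n
      have "(\<Prod>i\<in>{1..N}. A i (?\<sigma> i) (restrict n (inc i)))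
         = A u (?\<sigma> u) (restrict n (inc u)) * (A v (?\<sigma> v) (restrict n (inc v)) *
           (\<Prod>i\<in>{1..N} - {u} - {v}. A i (?\<sigma> i) (restrict n (inc i))))"
        using u v uv by (subst prod.remove[OF _ u], simp, subst prod.remove[of _ v]) auto
      also have "(\<Prod>i\<in>{1..N} - {u} - {v}. A i (?\<sigma> i) (restrict n (inc i))) = W n"
        unfolding W_def by (rule prod.cong) auto
      finally show "(\<Prod>i\<in>{1..N}. A i (?\<sigma> i) (restrict n (inc i)))
        = A u (code u b) (restrict n (inc u)) * A v (code v b') (restrict n (inc v)) * W n"
        using uv by (simp only: fun_upd_apply if_False if_True refl mult.assoc)
    qed
    finally show ?thesis ..
  qed
  \<comment> \<open>Applying the left inverses \<open>R\<close> and \<open>S\<close> to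
    \<open>slice\<close> isolates \<open>D\<close> on one side and keeps the product form on the
    other.\<close>
  have D_rank1: "D \<beta> \<gamma> = R \<beta> ou * S \<gamma> ov" if \<beta>: "\<beta> \<in> loc u" and \<gamma>: "\<gamma> \<in> loc v" for \<beta> \<gamma>
  proof -
    have "R \<beta> ou * S \<gamma> ov = (\<Sum>b\<in>loc u. \<Sum>b'\<in>loc v. R \<beta> b * S \<gamma> b' * (of_bool (b = ou) * of_bool (b' = ov)))"
    proof -
      have "(\<Sum>b\<in>loc u. \<Sum>b'\<in>loc v. R \<beta> b * S \<gamma> b' * (of_bool (b = ou) * of_bool (b' = ov)))
          = (\<Sum>b\<in>loc u. R \<beta> b * of_bool (b = ou)) * (\<Sum>b'\<in>loc v. S \<gamma> b' * of_bool (b' = ov))"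
        by (simp add: sum_product mult_ac)
      also have "\<dots> = R \<beta> ou * S \<gamma> ov"
        using ou ov finite_loc by (simp add: of_bool_def if_distrib cong: if_cong)
      finally show ?thesis ..
    qed
    also have "\<dots> = (\<Sum>b\<in>loc u. \<Sum>b'\<in>loc v. \<Sum>n\<in>bonds. R \<beta> b * S \<gamma> b' *
        (A u (code u b) (restrict n (inc u)) * A v (code v b') (restrict n (inc v)) * W n))"
      by (intro sum.cong refl) (simp add: slice[symmetric] sum_distrib_left)
    also have "\<dots> = (\<Sum>n\<in>bonds. \<Sum>b\<in>loc u. \<Sum>b'\<in>loc v. R \<beta> b * S \<gamma> b' *
        (A u (code u b) (restrict n (inc u)) * A v (code v b') (restrict n (inc v)) * W n))"
      by (subst sum.swap[of _ bonds "loc v"], subst sum.swap[of _ bonds "loc u"]) (rule refl)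
    also have "\<dots> = (\<Sum>n\<in>bonds. (\<Sum>b\<in>loc u. R \<beta> b * A u (code u b) (restrict n (inc u))) *
        (\<Sum>b'\<in>loc v. S \<gamma> b' * A v (code v b') (restrict n (inc v))) * W n)"
      by (rule sum.cong[OF refl], subst sum_product, subst sum_distrib_right, rule sum.cong[OF refl],
          subst sum_distrib_right) (simp add: mult_ac)
    also have "\<dots> = (\<Sum>n\<in>bonds. if restrict n (inc u) = \<beta> \<and> restrict n (inc v) = \<gamma> then W n else 0)"
      by (intro sum.cong refl) (auto simp: R_left S_left \<beta> \<gamma> restrict_bonds)
    also have "\<dots> = D \<beta> \<gamma>"
      unfolding D_def by (simp add: sum.inter_filter[OF finite_bonds])
    finally show ?thesis ..
  qed
  \<comment> \<open>\<open>D\<close> is the matrix \<open>1 \<otimes> B\<close>: it vanishes unless the two copies of the index of \<open>e\<close> agree,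
    and it does not depend on their common value.\<close>
  have D_diag: "D \<beta> \<gamma> = 0" if "\<beta> e \<noteq> \<gamma> e" for \<beta> \<gamma>
    unfolding D_def using that einc by (intro sum.neutral) auto
  \<comment> \<open>A diagonal entry of a product with an inverse is 1, so not all its summands
    vanish.\<close>
  obtain \<beta> where \<beta>: "\<beta> \<in> loc u" "R \<beta> ou \<noteq> 0"
    using R_right[OF ou ou] by (metis (mono_tags, lifting) mult_zero_right of_bool_eq(2) sum.neutral zero_neq_one)
  obtain \<gamma> where \<gamma>: "\<gamma> \<in> loc v" "S \<gamma> ov \<noteq> 0"
    using S_right[OF ov ov] by (metis (mono_tags, lifting) mult_zero_right of_bool_eq(2) sum.neutral zero_neq_one)
  have ne: "D \<beta> \<gamma> \<noteq> 0" using D_rank1 \<beta> \<gamma> by simp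
  then have same: "\<beta> e = \<gamma> e" using D_diag by blast
  \<comment> \<open>A second value for the bond \<open>e\<close>, available because
    \<open>m \<ge> 2\<close>.\<close>
  define l where "l = (if \<beta> e = 1 then 2 else 1 :: nat)"
  have l: "l \<in> {1..m}" "l \<noteq> \<beta> e" using m by (auto simp: l_def)
  have upd: "n(e := x) \<in> bonds" if "n \<in> bonds" "x \<in> {1..m}" for n x
    using that e by (auto simp: bond_configs_def PiE_def extensional_def)
  have upd_loc: "\<beta>(e := l) \<in> loc u" "\<gamma>(e := l) \<in> loc v"
    using \<beta>(1) \<gamma>(1) l einc by (auto simp: bond_configs_def PiE_def extensional_def)
  have \<beta>e: "\<beta> e \<in> {1..m}" using \<beta>(1) einc by (auto simp: bond_configs_def)
  have W_upd: "W (n(e := x)) = W n" for n x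
  proof -
    have "restrict (n(e := x)) (inc i) = restrict n (inc i)" if "i \<noteq> u" "i \<noteq> v" for i
      using that e by (auto simp: incident_edges_def fun_eq_iff)
    \<comment> \<open>Only \<open>u\<close> and \<open>v\<close> see the bond \<open>e\<close>, and
      \<open>W\<close> omits both.\<close>
    then show ?thesis unfolding W_def by (intro prod.cong) auto
  qed
  have res_upd: "restrict (n(e := x)) (inc i) = (restrict n (inc i))(e := x)" if "e \<in> inc i" for n x i
    using that by (auto simp: fun_eq_iff)
  have "D (\<beta>(e := l)) (\<gamma>(e := l)) = D \<beta> \<gamma>"
    unfolding D_def
  proof (rule sum.reindex_bij_witness[where i = "\<lambda>n. n(e := l)" and j = "\<lambda>n. n(e := \<beta> e)"], goal_cases)
    case (1 n)
    then have "n e = l" using einc by (auto simp: fun_eq_iff split: if_splits)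
    then show ?case by auto
  next
    case (2 n)
    then show ?case using upd[OF _ \<beta>e] einc same by (auto simp: res_upd)
  next
    case (3 n)
    then have "n e = \<beta> e" using einc by auto
    then show ?case by auto
  next
    case (4 n)
    then show ?case using upd[OF _ l(1)] einc by (auto simp: res_upd)
  next
    case (5 n)
    then show ?case by (simp add: W_upd)
  qed
  \<comment> \<open>A nonzero product has nonzero factors. Pairing the factor for the new value of
    \<open>e\<close> at \<open>u\<close> with the factor for the old value at \<open>v\<close>
    yields a nonzero entry where the two copies of \<open>e\<close> disagree.\<close>
  then have "R (\<beta>(e := l)) ou \<noteq> 0" using ne D_rank1[OF upd_loc] by auto
  then have "D (\<beta>(e := l)) \<gamma> \<noteq> 0" using D_rank1[OF upd_loc(1) \<gamma>(1)] \<gamma>(2) by simp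
  then show False using D_diag[of "\<beta>(e := l)" \<gamma>] l(2) same by simp
qed

section \<open>Failure of closedness\<close>

lemma not_closedin_PEPS: "\<not> closedin (norm_topology N d) (PEPS N E (\<lambda>e. m) d)"
proof
  assume closed: "closedin (norm_topology N d) (PEPS N E (\<lambda>e. m) d)"
  have ob: "obs ones \<in> site_configs N d" using obs_in ones_good by (simp add: good_def)
  have "\<Phi> (obs ones) = 1" using ones_good by (simp add: \<Phi>_def)
  then have "state_norm N d \<Phi> \<noteq> 0"
    using ob by (auto simp: state_norm_def L2_set_eq_0_iff finite_site_configs intro!: bexI[of _ "obs ones"])
  moreover have "\<Phi> \<in> tensor_space N d"
    using obs_in by (auto simp: tensor_space_def \<Phi>_def good_def)
  ultimately have "\<exists>B. \<Phi> = peps_state N E (\<lambda>e. m) d B"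
    using closedin_PEPS_limit[OF closed vs_range[OF L_gt(1)] _ _ approx_limit] by blast
  then show False using \<Phi>_not_peps_state by blast
qed

end

theorem proposition7:
  fixes N m :: nat and E :: "nat set set" and d :: "nat \<Rightarrow> nat"
  assumes "m \<ge> 2"
    and "simple_graph N E"
    and "connected_graph N E"
    and "\<exists>vs. is_cycle E vs"
    and "\<forall>i\<in>{1..N}. d i \<ge> m ^ vertex_degree E i"
  shows "\<not> closedin (norm_topology N d) (PEPS N E (\<lambda>e. m) d)"
proof -
  obtain vs where vs: "is_cycle E vs" using assms(4) by blast
  have "finite E"
    by (rule finite_subset[of _ "Pow {1..N}"]) (use assms(2) in \<open>auto simp: simple_graph_def\<close>)
  then have fin: "finite (incident_edges E i)" for i by (simp add: incident_edges_def)
  \<comment> \<open>The encodings exist by counting: vertex \<open>i\<close> has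
    \<open>m ^ vertex_degree E i\<close> local bond configurations.\<close>
  have "\<exists>f. inj_on f (bond_configs (incident_edges E i) (\<lambda>e. m)) \<and>
      f ` bond_configs (incident_edges E i) (\<lambda>e. m) \<subseteq> {1..d i}" if "i \<in> {1..N}" for i
  proof -
    have "card (bond_configs (incident_edges E i) (\<lambda>e. m)) = m ^ vertex_degree E i"
      using fin by (simp add: bond_configs_def card_PiE vertex_degree_def)
    also have "\<dots> \<le> card {1..d i}" using assms(5) that by simp
    finally have "card (bond_configs (incident_edges E i) (\<lambda>e. m)) \<le> card {1..d i}" .
    moreover have "finite (bond_configs (incident_edges E i) (\<lambda>e. m))"
      unfolding bond_configs_def using fin by (intro finite_PiE) auto
    ultimately show ?thesis using card_le_inj[of _ "{1..d i}"] by blast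
  qed
  then obtain code where code: "\<And>i. i \<in> {1..N} \<Longrightarrow>
      inj_on (code i) (bond_configs (incident_edges E i) (\<lambda>e. m)) \<and>
      code i ` bond_configs (incident_edges E i) (\<lambda>e. m) \<subseteq> {1..d i}"
    by metis
  interpret cycle_network N m E d vs code
    by standard (use assms(1,2) vs code in blast)+
  show ?thesis by (rule not_closedin_PEPS)
qed

end
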